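(* For every $n\ge2$, the set of synthetic flag positroids on $[n]$ equals the set of realizable flag positroids on $[n]$. That is, for every complete flag $F$ with $P_I(F)\ge0$ for all $I\subset[n]$ there is a flag $F'\in Fl_n^{\ge0}$ with $\{I:P_I(F')\ne0\}=\{I:P_I(F)\ne0\}$ (and conversely).
   Context: A complete flag in $\mathbb R^n$ is a chain $\{0\}=V_0\subsetneq V_1\subsetneq\cdots\subsetneq V_n=\mathbb R^n$; $Fl_n$ is the set of them. A flag is represented by an invertible real $n\times n$ matrix $M$ whose first $i$ rows span $V_i$; two matrices represent the same flag iff they differ by left multiplication by an invertible lower triangular matrix. For $I\subset[n]$, $P_I(M)$ is the determinant of the submatrix of $M$ in rows $\{1,\dots,|I|\}$ and columns $I$; the set $\{I: P_I(F)\neq 0\}$ is independent of the representative. "$P_I(F)\ge0$ for all $I$" means some representative $M$ has $P_I(M)\ge0$ for all $I$. $Fl_n^{\ge0}$ (Lusztig): for $1\le k<n$, $x_k(a)$ is the identity matrix with an extra entry $a$ in row $k$, column $k+1$; with $s_i=(i,i+1)$, $N=\binom n2$ and $s_{i_1}\cdots s_{i_N}=w_0$ the longest permutation, $U^+_{>0}=\{x_{i_1}(a_1)\cdots x_{i_N}(a_N):a_i>0\}$, and $Fl_n^{\ge0}$ is the closure in $Fl_n$ of the set of flags represented by elements of $U^+_{>0}$. A realizable flag positroid on $[n]$ is the set $\{I\subset[n]:P_I(F)\ne0\}$ for some $F\in Fl_n^{\ge0}$. A synthetic flag positroid on $[n]$ is the set $\{I\subset[n]:P_I(F)\ne0\}$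 for some $F\in Fl_n$ with $P_I(F)\ge0$ for all $I$. *)

theory Defs
  imports "Jordan_Normal_Form.Determinant" "Jordan_Normal_Form.DL_Submatrix"
          "HOL-Combinatorics.Transposition"
begin

text \<open>Conventions: indices are 0-based. [n] is rendered as {0..<n};
 matrices are n x n real matrices (Jordan_Normal_Form type mat).\<close>

definition GL :: "nat \<Rightarrow> real mat set" where
  "GL n = {M \<in> carrier_mat n n. invertible_mat M}"

definition Bminus :: "nat \<Rightarrow> real mat set" where
  "Bminus n = {L \<in> GL n. \<forall>i j. i < j \<longrightarrow> j < n \<longrightarrow> L $$ (i, j) = 0}"

definition same_flag :: "nat \<Rightarrow> real mat \<Rightarrow> real mat \<Rightarrow> bool" where
  "same_flag n M M' \<longleftrightarrow> M \<in> GL n \<and> (\<exists>L \<in> Bminus n. M' = L * M)"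

definition plucker :: "real mat \<Rightarrow> nat set \<Rightarrow> real" where
  "plucker M I = det (submatrix M {0..<card I} I)"

definition support :: "nat \<Rightarrow> real mat \<Rightarrow> nat set set" where
  "support n M = {I. I \<subseteq> {0..<n} \<and> plucker M I \<noteq> 0}"

definition xmat :: "nat \<Rightarrow> nat \<Rightarrow> real \<Rightarrow> real mat" where
  "xmat n k a = mat n n (\<lambda>(i, j). if i = j then 1 else if i = k \<and> j = Suc k then a else 0)"

definition w0 :: "nat \<Rightarrow> nat \<Rightarrow> nat" where
  "w0 n j = (if j < n then n - 1 - j else j)"

definition reduced_word_w0 :: "nat \<Rightarrow> nat list \<Rightarrow> bool" where
  "reduced_word_w0 n ws \<longleftrightarrow> set ws \<subseteq> {0..<n - 1} \<and> length ws = n choose 2 \<and>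
     foldr (\<lambda>k f. transpose k (Suc k) \<circ> f) ws id = w0 n"

definition Upos :: "nat \<Rightarrow> nat list \<Rightarrow> real mat set" where
  "Upos n ws = {foldr (\<lambda>(k, a) P. xmat n k a * P) (zip ws as) (1\<^sub>m n) | as.
                 length as = length ws \<and> (\<forall>a \<in> set as. a > 0)}"

text \<open>The flag of M lies in the closure (quotient topology on Fl_n = GL_n/B_-)
 of the set of flags represented by elements of Upos: M is an entrywise limit
 of matrices representing such flags.\<close>
definition tnn_flag :: "nat \<Rightarrow> nat list \<Rightarrow> real mat \<Rightarrow> bool" where
  "tnn_flag n ws M \<longleftrightarrow> M \<in> GL n \<and>
     (\<exists>X :: nat \<Rightarrow> real mat. (\<forall>k. \<exists>u \<in> Upos n ws. same_flag n u (X k)) \<and>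
        (\<forall>i < n. \<forall>j < n. (\<lambda>k. X k $$ (i, j)) \<longlonglongrightarrow> M $$ (i, j)))"

definition realizable_flag_positroid :: "nat \<Rightarrow> nat list \<Rightarrow> nat set set \<Rightarrow> bool" where
  "realizable_flag_positroid n ws S \<longleftrightarrow> (\<exists>M. tnn_flag n ws M \<and> S = support n M)"

definition synthetic_flag_positroid :: "nat \<Rightarrow> nat set set \<Rightarrow> bool" where
  "synthetic_flag_positroid n S \<longleftrightarrow>
     (\<exists>M \<in> GL n. (\<forall>I. I \<subseteq> {0..<n} \<longrightarrow> plucker M I \<ge> 0) \<and> S = support n M)"

end

theory Submission
  imports Defs
begin

text \<open>In fact a flag with nonnegative Plucker coordinates already lies in the closure of the
 positive part. Right multiplication by elementary bidiagonal matrices with small positive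
 parameters (in both triangular directions) never decreases a Plucker coordinate, and since any two
 column sets of equal size are connected by moving one column to a neighbouring position, it can be
 used to make all coordinates positive. If only the coordinates at intervals of columns are positive,
 Neville elimination of the first row writes the matrix as a lower triangular matrix times a
 positive product for one particular reduced word of the longest permutation; the elimination
 preserves positivity of interval minors up to positive factors. Any other reduced word gives the
 same positive products by Matsumoto's theorem and the braid relations for xmat. Conversely, on the
 positive part all coordinates of equal size have weakly the same sign, which survives in the limit
 and can be normalised by changing signs of rows.\<close>

section \<open>Plucker coordinates and column operations\<close>

text \<open>Columns are given by a function rather than a set, so replacing one column is a function
  update. The function need not be increasing; order matters only when translating back to
  \<open>plucker\<close>.\<close>

definition minor :: "real mat \<Rightarrow> nat \<Rightarrow> (nat \<Rightarrow> nat) \<Rightarrow> real" where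
  "minor M k f = det (mat k k (\<lambda>(i, j). M $$ (i, f j)))"

lemma minor_cong:
  "(\<And>i j. i < k \<Longrightarrow> j < k \<Longrightarrow> M $$ (i, f j) = N $$ (i, g j)) \<Longrightarrow> minor M k f = minor N k g"
  unfolding minor_def by (rule arg_cong[where f = det]) auto

text \<open>Exactly \<open>j\<close> elements of \<open>I\<close> lie below \<open>f j\<close>,
  namely the images of \<open>{..<j}\<close>, and \<open>pick\<close> inverts this count.\<close>

lemma pick_eqI:
  assumes "strict_mono_on {..<k} f" "f ` {..<k} = I" "j < k"
  shows "pick I j = f j"
proof -
  have "{a \<in> I. a < f j} = f ` {..<j}"
    using assms(1,3) strict_mono_on_less[OF assms(1)] unfolding assms(2)[symmetric] by fastforce
  moreover have "inj_on f {..<j}"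
    using strict_mono_on_imp_inj_on[OF assms(1)] inj_on_subset assms(3) by (metis lessThan_subset_iff less_imp_le)
  ultimately have "card {a \<in> I. a < f j} = j"
    by (simp add: card_image)
  moreover have "f j \<in> I" using assms by auto
  ultimately show ?thesis using pick_card_in_set[of "f j" I] by simp
qed

lemma strict_mono_pick:
  "finite I \<Longrightarrow> strict_mono_on {..<card I} (pick I)"
  by (rule strict_mono_onI) (auto intro: pick_mono)

lemma pick_image:
  assumes "finite I" shows "pick I ` {..<card I} = I"
proof (rule card_subset_eq)
  show "pick I ` {..<card I} \<subseteq> I" by (auto intro: pick_in_set)
  show "card (pick I ` {..<card I}) = card I"
    using strict_mono_on_imp_inj_on[OF strict_mono_pick[OF assms]] by (simp add: card_image)
qed fact

lemma plucker_pick: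
  assumes M: "M \<in> carrier_mat n n" and I: "I \<subseteq> {0..<n}"
  shows "plucker M I = minor M (card I) (pick I)"
proof -
  have c: "card I \<le> n" using card_mono[OF _ I] by simp
  have "{i. i < n \<and> i \<in> {0..<card I}} = {0..<card I}" "{j. j < n \<and> j \<in> I} = I"
    using I c by auto
  then have dim: "card {i. i < dim_row M \<and> i \<in> {0..<card I}} = card I"
    "card {j. j < dim_col M \<and> j \<in> I} = card I" using M by simp_all
  have pick: "pick {0..<card I} i = i" if "i < card I" for i
    using that by (intro pick_eqI[where k = "card I" and f = "\<lambda>x. x"]) (auto intro: strict_mono_onI)
  have "submatrix M {0..<card I} I = mat (card I) (card I) (\<lambda>(i, j). M $$ (i, pick I j))"
    unfolding submatrix_def dim by (intro cong_mat refl) (simp add: pick)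
  then show ?thesis
    unfolding plucker_def minor_def by simp
qed

lemma plucker_minor:
  assumes M: "M \<in> carrier_mat n n" and I: "I \<subseteq> {0..<n}"
    and f: "strict_mono_on {..<k} f" "f ` {..<k} = I"
  shows "plucker M I = minor M k f"
proof -
  have "card I = k"
    using f strict_mono_on_imp_inj_on[OF f(1)] by (metis card_image card_lessThan)
  then show ?thesis
    unfolding plucker_pick[OF M I] by (auto intro: minor_cong simp: pick_eqI[OF f])
qed

text \<open>Injectivity of \<open>f\<close> means that only column \<open>t\<close> of the submatrix
  is touched. Laplace expansion along that column is linear in it, with the same cofactors in all
  three determinants.\<close>

lemma minor_addcol:
  assumes M: "M \<in> carrier_mat n n" and "k \<le> n" "f ` {..<k} \<subseteq> {..<n}" "inj_on f {..<k}"
    and t: "t < k" "f t = q"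
  shows "minor (addcol a q p M) k f = minor M k f + a * minor M k (f(t := p))"
proof -
  define A where "A = mat k k (\<lambda>(i, j). addcol a q p M $$ (i, f j))"
  define B where "B = mat k k (\<lambda>(i, j). M $$ (i, f j))"
  define C where "C = mat k k (\<lambda>(i, j). M $$ (i, (f(t := p)) j))"
  have car: "A \<in> carrier_mat k k" "B \<in> carrier_mat k k" "C \<in> carrier_mat k k"
    by (simp_all add: A_def B_def C_def)
  have neq: "f j \<noteq> q" if "j < k" "j \<noteq> t" for j
    using that t assms(4) by (auto dest: inj_onD)
  have ltn: "f j < n" if "j < k" for j
    using that assms(3) by auto
  have off: "A $$ (i, j) = B $$ (i, j)" "C $$ (i, j) = B $$ (i, j)" if "i < k" "j < k" "j \<noteq> t" for i j
    using that M neq[OF that(2,3)] ltn[OF that(2)] \<open>k \<le> n\<close> by (auto simp: A_def B_def C_def)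
  have del: "mat_delete A i t = mat_delete B i t" "mat_delete C i t = mat_delete B i t" if "i < k" for i
    using that t car by (auto intro!: eq_matI simp: mat_delete_def off)
  have col: "A $$ (i, t) = B $$ (i, t) + a * C $$ (i, t)" if "i < k" for i
    using that t M ltn[OF t(1)] \<open>k \<le> n\<close> by (auto simp: A_def B_def C_def)
  have "det A = (\<Sum>i<k. A $$ (i, t) * cofactor A i t)"
    by (rule laplace_expansion_column[OF car(1) t(1)])
  also have "\<dots> = (\<Sum>i<k. B $$ (i, t) * cofactor B i t) + a * (\<Sum>i<k. C $$ (i, t) * cofactor C i t)"
    unfolding sum_distrib_left sum.distrib[symmetric]
    by (rule sum.cong) (auto simp: col cofactor_def del algebra_simps)
  also have "\<dots> = det B + a * det C"
    using laplace_expansion_column[OF car(2) t(1)] laplace_expansion_column[OF car(3) t(1)] by simp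
  finally show ?thesis
    unfolding minor_def A_def B_def C_def .
qed

lemma minor_repeated:
  assumes "i < k" "j < k" "i \<noteq> j" "f i = f j"
  shows "minor M k f = 0"
  unfolding minor_def
  by (rule det_identical_columns[OF _ assms(3,1,2)]) (use assms in \<open>auto intro!: eq_vecI\<close>)

text \<open>Adjacency of \<open>p\<close> and \<open>q\<close> is what keeps signs away: no column
  index lies between them, so replacing \<open>q\<close> by \<open>p\<close> preserves the
  increasing order. If \<open>p\<close> is already in \<open>I\<close>, the extra minor has two
  equal columns.\<close>

lemma plucker_addcol:
  assumes M: "M \<in> carrier_mat n n" and I: "I \<subseteq> {0..<n}" and pq: "p = Suc q \<or> q = Suc p" "p < n"
  shows "plucker (addcol a q p M) I =
    plucker M I + (if q \<in> I \<and> p \<notin> I then a * plucker M (insert p (I - {q})) else 0)"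
proof -
  define k f where "k = card I" and "f = pick I"
  have fin: "finite I" using I finite_subset by blast
  have f: "strict_mono_on {..<k} f" "f ` {..<k} = I"
    unfolding k_def f_def using strict_mono_pick pick_image fin by auto
  have inj: "inj_on f {..<k}" using f(1) by (rule strict_mono_on_imp_inj_on)
  have kn: "k \<le> n" using card_mono[OF _ I] by (simp add: k_def)
  have M': "addcol a q p M \<in> carrier_mat n n" using M by (simp add: mat_addcol_def)
  have ltn: "f j < n" if "j < k" for j using that f(2) I by auto
  have PM: "plucker M I = minor M k f" and PA: "plucker (addcol a q p M) I = minor (addcol a q p M) k f"
    using plucker_minor[OF M I f] plucker_minor[OF M' I f] .
  show ?thesis
  proof (cases "q \<in> I")
    case False
    then have "minor (addcol a q p M) k f = minor M k f"
      using f(2) M ltn kn by (intro minor_cong) auto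
    then show ?thesis using False PM PA by simp
  next
    case True
    then obtain t where t: "t < k" "f t = q" using f(2) by auto
    have e: "minor (addcol a q p M) k f = minor M k f + a * minor M k (f(t := p))"
      by (rule minor_addcol[OF M kn _ inj t]) (use f(2) I in auto)
    show ?thesis
    proof (cases "p \<in> I")
      case True
      then obtain s where s: "s < k" "f s = p" using f(2) by auto
      have "minor M k (f(t := p)) = 0"
        by (rule minor_repeated[of t _ s]) (use s t pq in auto)
      then show ?thesis using True PM PA e by simp
    next
      case False
      have im: "(f(t := p)) ` {..<k} = insert p (I - {q})"
        unfolding f(2)[symmetric] using t inj by (auto simp: inj_on_eq_iff image_iff)
      have np: "f j \<noteq> p" if "j < k" for j using False f(2) that by auto
      have sm: "strict_mono_on {..<k} (f(t := p))"
      proof (rule strict_mono_onI)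
        fix r s assume rs: "r \<in> {..<k}" "s \<in> {..<k}" "r < s"
        then have "f r < f s" using strict_mono_onD[OF f(1)] by auto
        then show "(f(t := p)) r < (f(t := p)) s"
          using rs np[of r] np[of s] t pq by auto
      qed
      have "plucker M (insert p (I - {q})) = minor M k (f(t := p))"
        by (rule plucker_minor[OF M _ sm im]) (use I pq in auto)
      then show ?thesis using True False PM PA e by simp
    qed
  qed
qed

section \<open>Products of elementary bidiagonal matrices\<close>

lemma xmat_addrow_mat: "Suc k < n \<Longrightarrow> xmat n k a = addrow_mat n a k (Suc k)"
  by (intro eq_matI) (auto simp: xmat_def)

lemma xmat_carrier [simp]: "xmat n k a \<in> carrier_mat n n"
  by (simp add: xmat_def)

lemma mult_xmat:
  "M \<in> carrier_mat m n \<Longrightarrow> Suc k < n \<Longrightarrow> M * xmat n k a = addcol a (Suc k) k M"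
  by (simp add: xmat_addrow_mat addcol_mat)

lemma xmat_mult:
  "M \<in> carrier_mat n m \<Longrightarrow> Suc k < n \<Longrightarrow> xmat n k a * M = addrow a k (Suc k) M"
  by (simp add: xmat_addrow_mat addrow_mat)

lemma Upos_Nil [simp]: "Upos n [] = {1\<^sub>m n}"
  by (auto simp: Upos_def)

lemma Upos_Cons: "Upos n (k # ws) = {xmat n k a * P | a P. a > 0 \<and> P \<in> Upos n ws}"
proof (intro equalityI subsetI)
  fix u assume "u \<in> Upos n (k # ws)"
  then obtain as where as: "u = foldr (\<lambda>(k, a) P. xmat n k a * P) (zip (k # ws) as) (1\<^sub>m n)"
    "length as = Suc (length ws)" "\<forall>a \<in> set as. a > 0" by (auto simp: Upos_def)
  then obtain b bs where "as = b # bs" by (cases as) auto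
  then show "u \<in> {xmat n k a * P | a P. a > 0 \<and> P \<in> Upos n ws}"
    using as by (auto simp: Upos_def)
next
  fix u assume "u \<in> {xmat n k a * P | a P. a > 0 \<and> P \<in> Upos n ws}"
  then obtain a as where "u = xmat n k a * foldr (\<lambda>(k, a) P. xmat n k a * P) (zip ws as) (1\<^sub>m n)"
    "a > 0" "length as = length ws" "\<forall>a \<in> set as. a > 0" by (auto simp: Upos_def)
  then show "u \<in> Upos n (k # ws)"
    by (auto simp: Upos_def intro!: exI[of _ "a # as"])
qed

lemma Upos_carrier: "u \<in> Upos n ws \<Longrightarrow> u \<in> carrier_mat n n"
  by (induction ws arbitrary: u) (auto simp: Upos_Cons intro!: mult_carrier_mat[of _ n n])

text \<open>Each factor adds to a coordinate at most a positive multiple of another, nonnegative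
  one. The matrix \<open>M\<close> is general so that the induction can absorb the leftmost factor
  into it.\<close>

lemma plucker_mult_Upos_nonneg:
  assumes "u \<in> Upos n ws" "set ws \<subseteq> {0..<n - 1}" "M \<in> carrier_mat n n"
    and "\<And>I. I \<subseteq> {0..<n} \<Longrightarrow> plucker M I \<ge> 0" and "I \<subseteq> {0..<n}"
  shows "plucker (M * u) I \<ge> 0"
  using assms
proof (induction ws arbitrary: u M)
  case Nil
  then show ?case by simp
next
  case (Cons k ws)
  then obtain a P where u: "u = xmat n k a * P" "a > 0" "P \<in> Upos n ws"
    by (auto simp: Upos_Cons)
  have k: "Suc k < n" using Cons.prems(2) by auto
  define M' where "M' = M * xmat n k a"
  have M': "M' \<in> carrier_mat n n" using Cons.prems(3) by (auto simp: M'_def)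
  have "plucker M' J \<ge> 0" if "J \<subseteq> {0..<n}" for J
  proof -
    have "plucker M (insert k (J - {Suc k})) \<ge> 0"
      by (rule Cons.prems(4)) (use that k in auto)
    then show ?thesis
      using Cons.prems(4)[OF that] that u(2) k unfolding M'_def mult_xmat[OF Cons.prems(3) k]
      by (subst plucker_addcol[OF Cons.prems(3)]) auto
  qed
  from Cons.IH[OF u(3) _ M' this Cons.prems(5)] have "plucker (M' * P) I \<ge> 0"
    using Cons.prems(2) by auto
  moreover have "M' * P = M * u"
    unfolding M'_def u(1) by (rule assoc_mult_mat[OF Cons.prems(3) xmat_carrier Upos_carrier[OF u(3)]])
  ultimately show ?case by simp
qed

lemma strict_mono_on_ge:
  fixes f :: "nat \<Rightarrow> nat"
  assumes "strict_mono_on {..<k} f" "j < k"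
  shows "j \<le> f j"
  using assms(2)
proof (induction j)
  case (Suc j)
  then show ?case using strict_mono_onD[OF assms(1), of j "Suc j"] by auto
qed simp

text \<open>Since \<open>pick I j\<close> is at least \<open>j\<close>, the submatrix of the
  identity is lower triangular with diagonal entries 0 or 1.\<close>

lemma plucker_one_nonneg:
  assumes I: "I \<subseteq> {0..<n}"
  shows "plucker (1\<^sub>m n) I \<ge> 0"
proof -
  have fin: "finite I" using I finite_subset by blast
  let ?A = "mat (card I) (card I) (\<lambda>(i, j). 1\<^sub>m n $$ (i, pick I j)) :: real mat"
  have c: "card I \<le> n" using card_mono[OF _ I] by simp
  have lt: "pick I j < n" if "j < card I" for j using pick_in_set[of j I] that I by auto
  have "det ?A = prod_list (diag_mat ?A)"
  proof (rule det_lower_triangular[of "card I"])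
    fix i j assume "i < j" "j < card I"
    then show "?A $$ (i, j) = 0"
      using c lt[of j] strict_mono_on_ge[OF strict_mono_pick[OF fin], of j] by auto
  qed simp
  also have "\<dots> \<ge> 0"
    unfolding prod_list_diag_prod using c lt by (auto intro!: prod_nonneg)
  finally show ?thesis by (simp add: plucker_pick[OF _ I] minor_def)
qed

lemma plucker_Upos_nonneg:
  assumes "u \<in> Upos n ws" "set ws \<subseteq> {0..<n - 1}" "I \<subseteq> {0..<n}"
  shows "plucker u I \<ge> 0"
  using plucker_mult_Upos_nonneg[OF assms(1,2) one_carrier_mat _ assms(3)] plucker_one_nonneg
    Upos_carrier[OF assms(1)] by simp

text \<open>The first \<open>k\<close> rows of \<open>L * M\<close> involve only the first
  \<open>k\<close> rows of \<open>M\<close>, so the submatrix factors. Hence changing the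
  representative of a flag scales all coordinates of one size by a common factor.\<close>

lemma minor_lower_mult:
  assumes L: "L \<in> carrier_mat n n" "\<And>i j. i < j \<Longrightarrow> j < n \<Longrightarrow> L $$ (i, j) = 0"
    and M: "M \<in> carrier_mat n n" and k: "k \<le> n" "f ` {..<k} \<subseteq> {..<n}"
  shows "minor (L * M) k f = (\<Prod>i<k. L $$ (i, i)) * minor M k f"
proof -
  let ?L = "mat k k (\<lambda>(i, j). L $$ (i, j))" and ?M = "mat k k (\<lambda>(i, j). M $$ (i, f j))"
  have "mat k k (\<lambda>(i, j). (L * M) $$ (i, f j)) = ?L * ?M"
  proof (rule eq_matI, goal_cases)
    case (1 i j)
    then have ij: "i < k" "j < k" "f j < n" using k by auto
    have "(\<Sum>t\<in>{0..<n}. L $$ (i, t) * M $$ (t, f j)) = (\<Sum>t\<in>{0..<k}. L $$ (i, t) * M $$ (t, f j))"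
      using k ij L(2) by (intro sum.mono_neutral_right) auto
    then show ?case using ij k L(1) M by (simp add: scalar_prod_def)
  qed auto
  then have "minor (L * M) k f = det ?L * det ?M"
    unfolding minor_def by (simp add: det_mult[of _ k])
  also have "det ?L = (\<Prod>i<k. L $$ (i, i))"
    using L(2) k by (subst det_lower_triangular[of k])
      (auto simp: prod_list_diag_prod atLeast0LessThan)
  finally show ?thesis by (simp add: minor_def)
qed

lemma plucker_lower_mult:
  assumes "L \<in> carrier_mat n n" "\<And>i j. i < j \<Longrightarrow> j < n \<Longrightarrow> L $$ (i, j) = 0"
    and "M \<in> carrier_mat n n" and I: "I \<subseteq> {0..<n}"
  shows "plucker (L * M) I = (\<Prod>i<card I. L $$ (i, i)) * plucker M I"
proof -
  have LM: "L * M \<in> carrier_mat n n" using assms by auto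
  have "card I \<le> n" "pick I ` {..<card I} \<subseteq> {..<n}"
    using card_mono[OF _ I] pick_image[of I] finite_subset[OF I] I by auto
  from minor_lower_mult[OF assms(1-3) this] show ?thesis
    unfolding plucker_pick[OF LM I] plucker_pick[OF assms(3) I] .
qed

lemma GL_iff: "M \<in> GL n \<longleftrightarrow> M \<in> carrier_mat n n \<and> det M \<noteq> 0"
proof
  assume "M \<in> GL n"
  then obtain B where M: "M \<in> carrier_mat n n" and B: "M * B = 1\<^sub>m n" "B * M = 1\<^sub>m (dim_row B)"
    by (auto simp: GL_def invertible_mat_def inverts_mat_def)
  have "dim_col B = n" using arg_cong[OF B(1), of dim_col] by simp
  moreover have "dim_row B = n" using arg_cong[OF B(2), of dim_col] M by simp
  ultimately have "B \<in> carrier_mat n n" by auto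
  from det_mult[OF M this] B(1) have "det M * det B = 1" by simp
  then show "M \<in> carrier_mat n n \<and> det M \<noteq> 0" using M by auto
next
  assume M: "M \<in> carrier_mat n n \<and> det M \<noteq> 0"
  from det_non_zero_imp_unit[of M n, where b = undefined] M obtain B where
    "B \<in> carrier_mat n n" "B * M = 1\<^sub>m n" "M * B = 1\<^sub>m n"
    by (auto simp: Units_def ring_mat_def)
  then show "M \<in> GL n"
    using M unfolding GL_def invertible_mat_def inverts_mat_def by auto
qed

section \<open>Reduced words and braid relations\<close>

abbreviation swap :: "nat \<Rightarrow> nat \<Rightarrow> nat" where
  "swap k \<equiv> transpose k (Suc k)"

text \<open>The inverse of the permutation spelled by a word: its inversions are then counted by
 comparing values at adjacent positions.\<close>
fun iperm :: "nat list \<Rightarrow> nat \<Rightarrow> nat" where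
  "iperm [] = id"
| "iperm (k # ws) = iperm ws \<circ> swap k"

definition inversions :: "nat \<Rightarrow> (nat \<Rightarrow> nat) \<Rightarrow> (nat \<times> nat) set" where
  "inversions n p = {(a, b). a < b \<and> b < n \<and> p b < p a}"

lemma finite_inversions [simp]: "finite (inversions n p)"
  by (rule finite_subset[of _ "{..<n} \<times> {..<n}"]) (auto simp: inversions_def)

lemma inversions_id [simp]: "inversions n id = {}"
  by (auto simp: inversions_def)

lemma swap_less: "a < b \<Longrightarrow> \<not> (a = k \<and> b = Suc k) \<Longrightarrow> swap k a < swap k b"
  by (auto simp: transpose_def)

lemma swap_bound: "Suc k < n \<Longrightarrow> b < n \<Longrightarrow> swap k b < n"
  by (auto simp: transpose_def)

text \<open>Applying \<open>swap k\<close> to both positions carries the old inversions injectively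
  to new ones, and the only further inversion is the pair \<open>(k, Suc k)\<close> itself.\<close>

lemma card_inversions_ascent:
  assumes k: "Suc k < n" and asc: "p k < p (Suc k)"
  shows "card (inversions n (p \<circ> swap k)) = Suc (card (inversions n p))"
proof -
  have "inversions n (p \<circ> swap k) = insert (k, Suc k) (map_prod (swap k) (swap k) ` inversions n p)"
  proof (intro equalityI subsetI)
    fix x assume "x \<in> inversions n (p \<circ> swap k)"
    then obtain a b where x: "x = (a, b)" "a < b" "b < n" "p (swap k b) < p (swap k a)"
      by (auto simp: inversions_def)
    show "x \<in> insert (k, Suc k) (map_prod (swap k) (swap k) ` inversions n p)"
    proof (cases "a = k \<and> b = Suc k")
      case False
      then have "(swap k a, swap k b) \<in> inversions n p"
        using x swap_less swap_bound[OF k] by (simp add: inversions_def)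
      then show ?thesis using x(1) by (intro insertI2 image_eqI[of _ _ "(swap k a, swap k b)"]) auto
    qed (simp add: x)
  next
    fix x assume "x \<in> insert (k, Suc k) (map_prod (swap k) (swap k) ` inversions n p)"
    then consider "x = (k, Suc k)" | a b where "x = (swap k a, swap k b)" "(a, b) \<in> inversions n p"
      by auto
    then show "x \<in> inversions n (p \<circ> swap k)"
    proof cases
      case 1
      then show ?thesis using k asc by (simp add: inversions_def)
    next
      case 2
      then have ab: "a < b" "b < n" "p b < p a" by (auto simp: inversions_def)
      then have "\<not> (a = k \<and> b = Suc k)" using asc by auto
      with ab show ?thesis using 2(1) swap_less swap_bound[OF k] by (simp add: inversions_def)
    qed
  qed
  moreover have "(k, Suc k) \<notin> map_prod (swap k) (swap k) ` inversions n p"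
  proof
    assume "(k, Suc k) \<in> map_prod (swap k) (swap k) ` inversions n p"
    then obtain a b where ab: "k = swap k a" "Suc k = swap k b" "a < b"
      by (auto simp: inversions_def)
    have "a = swap k (swap k a)" "b = swap k (swap k b)" by simp_all
    then have "a = Suc k" "b = k" unfolding ab(1,2)[symmetric] by simp_all
    then show False using \<open>a < b\<close> by simp
  qed
  moreover have "inj_on (map_prod (swap k) (swap k)) (inversions n p)"
    by (rule inj_on_subset[OF prod.inj_map]) auto
  ultimately show ?thesis by (simp add: card_image)
qed

lemma swap_swap [simp]: "p \<circ> swap k \<circ> swap k = p"
  by (simp add: comp_assoc)

lemma card_inversions_descent:
  assumes "Suc k < n" "p (Suc k) < p k"
  shows "card (inversions n p) = Suc (card (inversions n (p \<circ> swap k)))"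
  using card_inversions_ascent[of k n "p \<circ> swap k"] assms by simp

lemma iperm_permutes: "set ws \<subseteq> {0..<n - 1} \<Longrightarrow> iperm ws permutes {..<n}"
  by (induction ws) (auto simp: permutes_id intro!: permutes_compose permutes_swap_id)

lemma inj_iperm: "inj (iperm ws)"
proof (induction ws)
  case (Cons k ws)
  show ?case unfolding iperm.simps by (rule inj_compose[OF Cons]) simp
qed simp

lemma card_inversions_iperm_le:
  "set ws \<subseteq> {0..<n - 1} \<Longrightarrow> card (inversions n (iperm ws)) \<le> length ws"
proof (induction ws)
  case Nil
  show ?case unfolding iperm.simps inversions_id by simp
next
  case (Cons k ws)
  then have k: "Suc k < n" by auto
  have "iperm ws k \<noteq> iperm ws (Suc k)"
    using inj_iperm[of ws] by (simp add: inj_eq)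
  then consider "iperm ws k < iperm ws (Suc k)" | "iperm ws (Suc k) < iperm ws k" by linarith
  then have "card (inversions n (iperm ws \<circ> swap k)) \<le> Suc (card (inversions n (iperm ws)))"
    using card_inversions_ascent[OF k, of "iperm ws"] card_inversions_descent[OF k, of "iperm ws"]
    by cases linarith+
  moreover have "card (inversions n (iperm ws)) \<le> length ws"
    using Cons by simp
  ultimately show ?case unfolding iperm.simps list.size by linarith
qed

text \<open>The inversion count stands for Coxeter length, which avoids a minimum over all words.
  Here \<open>p\<close> is the inverse of the permutation that the word spells.\<close>

definition reduced_word :: "nat \<Rightarrow> (nat \<Rightarrow> nat) \<Rightarrow> nat list \<Rightarrow> bool" where
  "reduced_word n p ws \<longleftrightarrow>
    set ws \<subseteq> {0..<n - 1} \<and> iperm ws = p \<and> length ws = card (inversions n p)"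

lemma reduced_word_ConsI:
  "reduced_word n (p \<circ> swap k) ws \<Longrightarrow> Suc k < n \<Longrightarrow> p (Suc k) < p k \<Longrightarrow> reduced_word n p (k # ws)"
  using card_inversions_descent[of k n p] by (auto simp: reduced_word_def)

text \<open>If the first letter were an ascent, the remaining word would spell a permutation with
  more inversions than it has letters.\<close>

lemma reduced_word_ConsD:
  assumes "reduced_word n p (k # ws)"
  shows "Suc k < n" "p (Suc k) < p k" "reduced_word n (p \<circ> swap k) ws"
proof -
  show k: "Suc k < n" using assms by (auto simp: reduced_word_def)
  have q: "iperm ws = p \<circ> swap k" and len: "Suc (length ws) = card (inversions n p)"
    using assms by (auto simp: reduced_word_def)
  have le: "card (inversions n (p \<circ> swap k)) \<le> length ws"
    using card_inversions_iperm_le[of ws n] assms q by (auto simp: reduced_word_def)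
  have "inj p" using inj_iperm[of "k # ws"] assms unfolding reduced_word_def by blast
  then have "p k \<noteq> p (Suc k)" by (simp add: inj_eq)
  moreover have "\<not> p k < p (Suc k)"
    using card_inversions_ascent[OF k, of p] le len by auto
  ultimately show d: "p (Suc k) < p k" by linarith
  show "reduced_word n (p \<circ> swap k) ws"
    using card_inversions_descent[OF k d] q len assms by (auto simp: reduced_word_def)
qed

lemma ascending_permutes_id:
  fixes p :: "nat \<Rightarrow> nat"
  assumes "p permutes {..<n}" "\<And>k. Suc k < n \<Longrightarrow> p k < p (Suc k)"
  shows "p = id"
proof (rule permutes_natset_ge[OF assms(1)], intro ballI)
  fix i assume "i \<in> {..<n}"
  then have "i < n" by simp
  then show "i \<le> p i"
  proof (induction i)
    case (Suc i)
    then show ?case using assms(2)[of i] by simp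
  qed simp
qed

text \<open>Bubble sort: each descent removed lowers the inversion count by one, and a permutation
  without descents is the identity.\<close>

lemma reduced_word_exists:
  assumes "p permutes {..<n}"
  shows "\<exists>ws. reduced_word n p ws"
  using assms
proof (induction "card (inversions n p)" arbitrary: p rule: less_induct)
  case less
  show ?case
  proof (cases "\<exists>k. Suc k < n \<and> p (Suc k) < p k")
    case True
    then obtain k where k: "Suc k < n" "p (Suc k) < p k" by blast
    have "p \<circ> swap k permutes {..<n}"
      using k by (intro permutes_compose[OF _ less.prems] permutes_swap_id) auto
    then obtain ws where "reduced_word n (p \<circ> swap k) ws"
      using less.hyps card_inversions_descent[OF k] by auto
    then show ?thesis using reduced_word_ConsI k by blast
  next
    case False
    have "p k < p (Suc k)" if "Suc k < n" for k
    proof -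
      have "p k \<noteq> p (Suc k)" using permutes_inj[OF less.prems] by (simp add: inj_eq)
      then show ?thesis using False that by (meson nat_neq_iff)
    qed
    then have p: "p = id" by (rule ascending_permutes_id[OF less.prems])
    have "reduced_word n p []"
      unfolding reduced_word_def p inversions_id iperm.simps by simp
    then show ?thesis by blast
  qed
qed

section \<open>Commutation and braid moves on positive products\<close>

lemma Upos_Cons_mono: "Upos n ws \<subseteq> Upos n vs \<Longrightarrow> Upos n (k # ws) \<subseteq> Upos n (k # vs)"
  by (auto simp: Upos_Cons)

text \<open>Neither of the two row operations reads or writes the row that the other
  changes.\<close>

lemma Upos_commute:
  assumes "Suc k < n" "Suc l < n" "k \<noteq> l" "Suc k \<noteq> l" "Suc l \<noteq> k"
  shows "Upos n (k # l # ws) \<subseteq> Upos n (l # k # ws)"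
proof
  fix u assume "u \<in> Upos n (k # l # ws)"
  then obtain a b P where u: "u = xmat n k a * (xmat n l b * P)" "a > 0" "b > 0" "P \<in> Upos n ws"
    by (auto simp: Upos_Cons)
  have P: "P \<in> carrier_mat n n" using u(4) by (rule Upos_carrier)
  have "addrow a k (Suc k) (addrow b l (Suc l) P) = addrow b l (Suc l) (addrow a k (Suc k) P)"
    using P assms by (auto intro!: eq_matI)
  then have "u = xmat n l b * (xmat n k a * P)"
    unfolding u(1) using assms P
    by (simp add: xmat_mult[of P n n] xmat_mult[of _ n n])
  then show "u \<in> Upos n (l # k # ws)"
    using u by (auto simp: Upos_Cons)
qed

text \<open>The new parameters are subtraction-free rational functions of the old ones, so
  positivity survives the move.\<close>

lemma Upos_braid:
  assumes "Suc k < n" "Suc l < n" "l = Suc k \<or> k = Suc l"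
  shows "Upos n (k # l # k # ws) \<subseteq> Upos n (l # k # l # ws)"
proof
  fix u assume "u \<in> Upos n (k # l # k # ws)"
  then obtain a b c P where u: "u = xmat n k a * (xmat n l b * (xmat n k c * P))"
    "a > 0" "b > 0" "c > 0" "P \<in> Upos n ws"
    by (auto simp: Upos_Cons)
  have P: "P \<in> carrier_mat n n" using u(5) by (rule Upos_carrier)
  \<comment> \<open>\<open>x\<^sub>k(a) x\<^sub>l(b) x\<^sub>k(c) = x\<^sub>l(a') x\<^sub>k(b') x\<^sub>l(c')\<close>\<close>
  define a' b' c' where "a' = b * c / (a + c)" and "b' = a + c" and "c' = a * b / (a + c)"
  have pos: "a' > 0" "b' > 0" "c' > 0" using u by (simp_all add: a'_def b'_def c'_def)
  have ac: "a + c \<noteq> 0" using u(2,4) by simp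
  have "a' + c' = b * (a + c) / (a + c)"
    unfolding a'_def c'_def add_divide_distrib[symmetric] by (simp add: algebra_simps)
  \<comment> \<open>The corner entry of the triple product requires \<open>b' * c' = a * b\<close>
    if \<open>l = Suc k\<close> and \<open>a' * b' = b * c\<close> if \<open>k = Suc l\<close>; the
    same parameters satisfy both.\<close>
  then have eqs: "a' + c' = b" "a' * b' = b * c" "b' * c' = a * b" "b' = a + c"
    using ac by (simp_all add: a'_def b'_def c'_def)
  have "addrow a k (Suc k) (addrow b l (Suc l) (addrow c k (Suc k) P))
    = addrow a' l (Suc l) (addrow b' k (Suc k) (addrow c' l (Suc l) P))" (is "?l = ?r")
  proof (rule eq_matI)
    fix i j assume "i < dim_row ?r" "j < dim_col ?r"
    then have ij: "i < n" "j < n" using P by auto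
    have e: "a' * (b' * x) = b * (c * x)" "b' * (c' * x) = a * (b * x)" "a' * x + c' * x = b * x" for x
      using eqs by (metis mult.assoc, metis mult.assoc, metis distrib_right)
    show "?l $$ (i, j) = ?r $$ (i, j)"
      using assms ij P e[of "P $$ (Suc k, j)"] e[of "P $$ (Suc l, j)"] e[of "P $$ (Suc (Suc k), j)"] e[of "P $$ (Suc (Suc l), j)"] eqs(4)
      by (auto simp: algebra_simps)
  qed (use P in auto)
  then have "u = xmat n l a' * (xmat n k b' * (xmat n l c' * P))"
    unfolding u(1) using assms P
    by (simp add: xmat_mult[of P n n] xmat_mult[of _ n n])
  then show "u \<in> Upos n (l # k # l # ws)"
    using u(5) pos unfolding Upos_Cons by blast
qed

text \<open>Matsumoto's argument: if two reduced words start with different letters k and l, both are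
 descents, so there is a reduced word starting with the longest element of the subgroup generated
 by these two reflections, and the words are compared through it.\<close>
lemma Upos_reduced_word_subset:
  assumes "reduced_word n p ws" "reduced_word n p vs"
  shows "Upos n ws \<subseteq> Upos n vs"
  using assms
proof (induction "length ws" arbitrary: p ws vs)
  case 0
  then have "length vs = length ws" unfolding reduced_word_def by presburger
  then show ?case using 0 by simp
next
  case (Suc N)
  obtain k as where ws: "ws = k # as" using Suc.hyps(2) by (cases ws) auto
  have "length vs = length ws" using Suc.prems by (simp add: reduced_word_def)
  then obtain l bs where vs: "vs = l # bs" using Suc.hyps(2) by (cases vs) auto
  note a = reduced_word_ConsD[OF Suc.prems(1)[unfolded ws]]
  note b = reduced_word_ConsD[OF Suc.prems(2)[unfolded vs]]
  have lena: "N = length as" and lenb: "N = length bs"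
    using Suc.hyps(2) \<open>length vs = length ws\<close> by (simp_all add: ws vs)
  have p: "p permutes {..<n}"
    using Suc.prems(1) iperm_permutes by (auto simp: reduced_word_def)
  have perm: "q \<circ> swap i permutes {..<n}" if "q permutes {..<n}" "Suc i < n" for q i
    using that by (intro permutes_compose[OF _ that(1)] permutes_swap_id) auto
  have step: "Upos n as \<subseteq> Upos n xs" if "reduced_word n (p \<circ> swap k) xs" for xs
    using Suc.hyps(1)[OF lena a(3) that] .
  \<comment> \<open>The induction hypothesis is used here with \<open>xs\<close> as the first word;
    \<open>xs\<close> and \<open>bs\<close> are reduced for the same permutation, so they have equal
    length.\<close>
  have step': "Upos n xs \<subseteq> Upos n bs" if "reduced_word n (p \<circ> swap l) xs" for xs
    by (rule Suc.hyps(1)[OF _ that b(3)])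
      (use that b(3) lenb in \<open>simp add: reduced_word_def\<close>)
  consider "k = l" | "k \<noteq> l" "Suc k \<noteq> l" "Suc l \<noteq> k" | "l = Suc k \<or> k = Suc l" by blast
  then show ?case
  proof cases
    case 1
    then have "Upos n as \<subseteq> Upos n bs" using step b(3) by blast
    then show ?thesis using 1 Upos_Cons_mono unfolding ws vs by blast
  next
    case 2
    obtain v where v: "reduced_word n (p \<circ> swap k \<circ> swap l) v"
      using reduced_word_exists[OF perm[OF perm[OF p a(1)] b(1)]] by blast
    have comm: "p \<circ> swap k \<circ> swap l = p \<circ> swap l \<circ> swap k"
      using 2 by (auto simp: fun_eq_iff transpose_def)
    have "reduced_word n (p \<circ> swap k) (l # v)"
      by (rule reduced_word_ConsI[OF v b(1)]) (use b(2) 2 in \<open>simp add: transpose_def\<close>)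
    moreover have "reduced_word n (p \<circ> swap l) (k # v)"
      by (rule reduced_word_ConsI[OF v[unfolded comm] a(1)]) (use a(2) 2 in \<open>simp add: transpose_def\<close>)
    ultimately show ?thesis
      using Upos_Cons_mono[OF step] Upos_Cons_mono[OF step'] Upos_commute[OF a(1) b(1) 2(1,2,3)]
      unfolding ws vs by blast
  next
    case 3
    obtain v where v: "reduced_word n (p \<circ> swap k \<circ> swap l \<circ> swap k) v"
      using reduced_word_exists[OF perm[OF perm[OF perm[OF p a(1)] b(1)] a(1)]] by blast
    have braid: "p \<circ> swap k \<circ> swap l \<circ> swap k = p \<circ> swap l \<circ> swap k \<circ> swap l"
      using 3 by (auto simp: fun_eq_iff transpose_def)
    \<comment> \<open>Having descents at both \<open>k\<close> and \<open>l\<close>,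
      \<open>p\<close> decreases on all three positions involved, so every letter split off is a
      descent.\<close>
    have "reduced_word n (p \<circ> swap k) (l # k # v)"
      by (intro reduced_word_ConsI[OF _ b(1)] reduced_word_ConsI[OF v a(1)])
        (use a(2) b(2) 3 in \<open>auto simp: transpose_def\<close>)
    moreover have "reduced_word n (p \<circ> swap l) (k # l # v)"
      by (intro reduced_word_ConsI[OF _ a(1)] reduced_word_ConsI[OF v[unfolded braid] b(1)])
        (use a(2) b(2) 3 in \<open>auto simp: transpose_def\<close>)
    ultimately show ?thesis
      using Upos_Cons_mono[OF step] Upos_Cons_mono[OF step'] Upos_braid[OF a(1) b(1) 3]
      unfolding ws vs by blast
  qed
qed

section \<open>Reduced words of the longest permutation\<close>

lemma card_inversions_w0: "card (inversions n (w0 n)) = n choose 2"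
proof -
  have "inversions n (w0 n) = prod.swap ` (SIGMA b:{..<n}. {..<b})"
    by (force simp: inversions_def w0_def)
  then have "card (inversions n (w0 n)) = (\<Sum>b<n. b)"
    by (simp add: card_image)
  also have "\<dots> = n choose 2"
    by (induction n) (simp_all add: numeral_2_eq_2)
  finally show ?thesis .
qed

lemma foldr_swap_iperm: "foldr (\<lambda>k f. swap k \<circ> f) ws id \<circ> iperm ws = id"
  by (induction ws) (simp_all add: fun_eq_iff)

text \<open>The longest permutation is an involution, so passing to the inverse in
  \<open>iperm\<close> does not change it.\<close>

lemma reduced_word_w0_imp_reduced:
  assumes "reduced_word_w0 n ws"
  shows "reduced_word n (w0 n) ws"
proof -
  have "w0 n \<circ> iperm ws = id"
    using foldr_swap_iperm[of ws] assms by (simp add: reduced_word_w0_def)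
  then have e: "w0 n (iperm ws x) = x" for x by (simp add: fun_eq_iff)
  have "w0 n (w0 n y) = y" for y by (auto simp: w0_def)
  then have "iperm ws = w0 n" using e by (metis ext)
  then show ?thesis
    using assms by (simp add: reduced_word_def reduced_word_w0_def card_inversions_w0)
qed

text \<open>The word is shaped after the elimination: the tail \<open>[0..<n]\<close> records the
  column operations that clear the first row, and the shifted word before it handles the remaining
  block.\<close>

fun staircase :: "nat \<Rightarrow> nat list" where
  "staircase 0 = []"
| "staircase (Suc n) = map Suc (staircase n) @ [0..<n]"

lemma iperm_append: "iperm (ws @ vs) = iperm vs \<circ> iperm ws"
  by (induction ws) (simp_all add: comp_assoc)

lemma iperm_map_Suc: "iperm (map Suc ws) x = (case x of 0 \<Rightarrow> 0 | Suc y \<Rightarrow> Suc (iperm ws y))"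
proof (induction ws arbitrary: x)
  case (Cons k ws)
  have "swap (Suc k) x = (case x of 0 \<Rightarrow> 0 | Suc y \<Rightarrow> Suc (swap k y))"
    by (auto simp: transpose_def split: nat.splits)
  then show ?case by (auto simp: Cons split: nat.splits)
qed (auto split: nat.splits)

lemma iperm_upt: "iperm [0..<n] x = (if x = 0 then n else if x \<le> n then x - 1 else x)"
  by (induction n arbitrary: x) (auto simp: iperm_append transpose_def)

lemma reduced_word_staircase: "reduced_word n (w0 n) (staircase n)"
proof -
  have "set (staircase n) \<subseteq> {0..<n - 1}"
  proof (induction n)
    case (Suc n)
    then show ?case by force
  qed simp
  moreover have "iperm (staircase n) = w0 n"
  proof (induction n)
    case (Suc n)
    then show ?case
      by (auto simp: fun_eq_iff iperm_append iperm_map_Suc iperm_upt w0_def split: nat.splits)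
  qed (simp add: w0_def fun_eq_iff)
  moreover have "length (staircase n) = n choose 2"
    by (induction n) (simp_all add: numeral_2_eq_2)
  ultimately show ?thesis by (simp add: reduced_word_def card_inversions_w0)
qed

lemma Upos_reduced_word_w0:
  "reduced_word_w0 n ws \<Longrightarrow> Upos n (staircase n) \<subseteq> Upos n ws"
  using Upos_reduced_word_subset reduced_word_staircase reduced_word_w0_imp_reduced by blast

section \<open>Neville elimination\<close>

text \<open>From every column but the first, subtract the multiple of its original left neighbour
  that clears the top entry. This is right multiplication by the unipotent bidiagonal matrix
  \<open>E\<close>; then expand along the top row.\<close>

lemma det_eliminate_row:
  fixes b :: "nat \<Rightarrow> nat \<Rightarrow> real"
  assumes "\<And>t. t \<le> k \<Longrightarrow> b 0 t \<noteq> 0"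
  shows "det (mat (Suc k) (Suc k) (\<lambda>(i, t). b i t)) =
    b 0 0 * det (mat k k (\<lambda>(i, t). b (Suc i) (Suc t) - b 0 (Suc t) / b 0 t * b (Suc i) t))"
proof -
  define B where "B = mat (Suc k) (Suc k) (\<lambda>(i, t). b i t)"
  define E where "E = mat (Suc k) (Suc k)
    (\<lambda>(s, t). if s = t then 1 else if t = Suc s then - (b 0 t / b 0 s) else 0)"
  define C where "C = mat (Suc k) (Suc k)
    (\<lambda>(i, t). if t = 0 then b i 0 else b i t - b 0 t / b 0 (t - 1) * b i (t - 1))"
  have car: "B \<in> carrier_mat (Suc k) (Suc k)" "E \<in> carrier_mat (Suc k) (Suc k)"
    "C \<in> carrier_mat (Suc k) (Suc k)"
    by (simp_all add: B_def E_def C_def)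
  have "det E = (\<Prod>i = 0..<Suc k. E $$ (i, i))"
    using det_upper_triangular[OF _ car(2)] car(2)
    by (auto simp: upper_triangular_def E_def prod_list_diag_prod)
  then have "det E = 1" by (simp add: E_def)
  have "B * E = C"
  proof (rule eq_matI)
    fix i t assume "i < dim_row C" "t < dim_col C"
    then have it: "i < Suc k" "t < Suc k" using car by auto
    have "(B * E) $$ (i, t) = (\<Sum>s = 0..<Suc k. B $$ (i, s) * E $$ (s, t))"
      using it car by (simp add: scalar_prod_def)
    \<comment> \<open>For \<open>t = 0\<close> the truncated \<open>t - 1\<close> is again 0; the
      inner conditional suppresses the spurious term.\<close>
    also have "\<dots> = (\<Sum>s = 0..<Suc k. (if s = t then b i s else 0)
        + (if s = t - 1 then if t = 0 then 0 else - (b 0 t / b 0 s) * b i s else 0))"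
      using it by (intro sum.cong) (auto simp: B_def E_def)
    also have "\<dots> = C $$ (i, t)"
      using it by (simp only: sum.distrib sum.delta finite_atLeastLessThan) (auto simp: C_def)
    finally show "(B * E) $$ (i, t) = C $$ (i, t)" .
  qed (use car in auto)
  then have "det B = det C"
    using det_mult[OF car(1,2)] \<open>det E = 1\<close> by simp
  also have "\<dots> = (\<Sum>t<Suc k. C $$ (0, t) * cofactor C 0 t)"
    by (rule laplace_expansion_row[OF car(3)]) simp
  also have "\<dots> = (\<Sum>t<Suc k. if t = 0 then C $$ (0, t) * cofactor C 0 t else 0)"
    by (rule sum.cong) (auto simp: C_def assms)
  also have "\<dots> = C $$ (0, 0) * cofactor C 0 0"
    by (subst sum.delta) auto
  also have "\<dots> = b 0 0 * det (mat_delete C 0 0)"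
    by (simp add: C_def cofactor_def)
  also have "mat_delete C 0 0 =
      mat k k (\<lambda>(i, t). b (Suc i) (Suc t) - b 0 (Suc t) / b 0 t * b (Suc i) t)"
    by (rule eq_matI) (auto simp: mat_delete_def C_def)
  finally show ?thesis unfolding B_def .
qed

section \<open>Factorization along the staircase word\<close>

lemma Upos_append:
  "u \<in> Upos n ws \<Longrightarrow> v \<in> Upos n vs \<Longrightarrow> u * v \<in> Upos n (ws @ vs)"
proof (induction ws arbitrary: u)
  case Nil
  then show ?case using Upos_carrier[OF Nil(2)] by simp
next
  case (Cons k ws)
  then obtain a P where u: "u = xmat n k a * P" "a > 0" "P \<in> Upos n ws"
    by (auto simp: Upos_Cons)
  have "u * v = xmat n k a * (P * v)"
    unfolding u(1) by (rule assoc_mult_mat[OF xmat_carrier Upos_carrier[OF u(3)] Upos_carrier[OF Cons.prems(2)]])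
  moreover have "P * v \<in> Upos n (ws @ vs)" using Cons u(3) by blast
  ultimately show ?case using u(2) unfolding append_Cons Upos_Cons by blast
qed

text \<open>Embedding as the lower right block, the matrix counterpart of \<open>map Suc\<close> on
  words.\<close>

definition shift_mat :: "real mat \<Rightarrow> real mat" where
  "shift_mat A = four_block_mat (1\<^sub>m 1) (0\<^sub>m 1 (dim_col A)) (0\<^sub>m (dim_row A) 1) A"

lemma shift_mat_carrier: "A \<in> carrier_mat n n \<Longrightarrow> shift_mat A \<in> carrier_mat (Suc n) (Suc n)"
  by (auto simp: shift_mat_def)

lemma shift_mat_mult:
  assumes "A \<in> carrier_mat n n" "B \<in> carrier_mat n n"
  shows "shift_mat (A * B) = shift_mat A * shift_mat B"
  using assms unfolding shift_mat_def
  by (subst mult_four_block_mat[of _ 1 1 _ n _ n _ _ 1 _ n]) auto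

lemma shift_mat_xmat: "shift_mat (xmat n k a) = xmat (Suc n) (Suc k) a"
  by (rule eq_matI) (auto simp: shift_mat_def xmat_def)

lemma shift_mat_one: "shift_mat (1\<^sub>m n) = 1\<^sub>m (Suc n)"
  using four_block_one_mat[of 1 n] by (simp add: shift_mat_def)

lemma shift_mat_Upos: "u \<in> Upos n ws \<Longrightarrow> shift_mat u \<in> Upos (Suc n) (map Suc ws)"
proof (induction ws arbitrary: u)
  case Nil
  then show ?case by (simp add: shift_mat_one)
next
  case (Cons k ws)
  then obtain a P where u: "u = xmat n k a * P" "a > 0" "P \<in> Upos n ws"
    by (auto simp: Upos_Cons)
  have "shift_mat u = xmat (Suc n) (Suc k) a * shift_mat P"
    unfolding u(1) shift_mat_mult[OF xmat_carrier Upos_carrier[OF u(3)]] shift_mat_xmat ..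
  then show ?case using Cons.IH[OF u(3)] u(2) unfolding list.map Upos_Cons by blast
qed

text \<open>The elimination is undone from left to right: once column \<open>k\<close> has its
  original value, adding the right multiple of it restores column \<open>Suc k\<close>. The
  multipliers are quotients of positive top entries.\<close>

lemma Upos_eliminate_row:
  assumes M: "M \<in> carrier_mat (Suc n) (Suc n)" and pos: "\<And>t. t \<le> n \<Longrightarrow> M $$ (0, t) > 0"
  shows "\<exists>Q \<in> Upos (Suc n) [0..<n]. mat (Suc n) (Suc n) (\<lambda>(i, j). if j = 0 then M $$ (i, 0)
    else M $$ (i, j) - M $$ (0, j) / M $$ (0, j - 1) * M $$ (i, j - 1)) * Q = M"
proof -
  \<comment> \<open>\<open>N k\<close> has its columns up to \<open>k\<close> restored, so it runs
    from the eliminated matrix at 0 to \<open>M\<close> at \<open>n\<close>.\<close>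
  define N where "N k = mat (Suc n) (Suc n) (\<lambda>(i, j). if j \<le> k then M $$ (i, j)
    else M $$ (i, j) - M $$ (0, j) / M $$ (0, j - 1) * M $$ (i, j - 1))" for k :: nat
  have N: "N k \<in> carrier_mat (Suc n) (Suc n)" for k by (simp add: N_def)
  have "\<exists>Q \<in> Upos (Suc n) [0..<k]. N 0 * Q = N k" if "k \<le> n" for k
    using that
  proof (induction k)
    case 0
    then show ?case using right_mult_one_mat[OF N] by simp
  next
    case (Suc k)
    then obtain Q where Q: "Q \<in> Upos (Suc n) [0..<k]" "N 0 * Q = N k" by auto
    define a where "a = M $$ (0, Suc k) / M $$ (0, k)"
    have "a > 0" using pos[of k] pos[of "Suc k"] Suc.prems by (simp add: a_def)
    then have x: "xmat (Suc n) k a \<in> Upos (Suc n) [k]"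
      unfolding Upos_Cons using right_mult_one_mat[OF xmat_carrier] by force
    have "N k * xmat (Suc n) k a = addcol a (Suc k) k (N k)"
      by (rule mult_xmat[OF N]) (use Suc.prems in simp)
    also have "\<dots> = N (Suc k)"
      using Suc.prems by (auto intro!: eq_matI simp: N_def a_def)
    finally have "N k * xmat (Suc n) k a = N (Suc k)" .
    then have "N 0 * (Q * xmat (Suc n) k a) = N (Suc k)"
      using assoc_mult_mat[OF N Upos_carrier[OF Q(1)] xmat_carrier] Q(2) by metis
    then show ?case using Upos_append[OF Q(1) x] by auto
  qed
  from this[OF order_refl] obtain Q where Q: "Q \<in> Upos (Suc n) [0..<n]" "N 0 * Q = N n" ..
  have "N n = M" using M by (auto intro!: eq_matI simp: N_def)
  moreover have "N 0 = mat (Suc n) (Suc n) (\<lambda>(i, j). if j = 0 then M $$ (i, 0)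
    else M $$ (i, j) - M $$ (0, j) / M $$ (0, j - 1) * M $$ (i, j - 1))"
    by (auto intro!: eq_matI simp: N_def)
  ultimately show ?thesis using Q by (intro bexI[OF _ Q(1)]) (simp only:)
qed

text \<open>Clearing the first row with left neighbours keeps column intervals intact: a minor of
  the remaining block \<open>D\<close> on an interval is the minor of \<open>M\<close> on the
  interval of one more column, divided by a positive top entry. So \<open>D\<close> satisfies the
  hypothesis again.\<close>

lemma interval_minors_factorization:
  assumes "M \<in> carrier_mat n n" "\<And>m k. m + k \<le> n \<Longrightarrow> minor M k (\<lambda>t. m + t) > 0"
  shows "\<exists>L \<in> Bminus n. \<exists>u \<in> Upos n (staircase n). M = L * u"
  using assms
proof (induction n arbitrary: M)
  case 0
  show ?case
  proof (intro bexI)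
    show "M = 1\<^sub>m 0 * 1\<^sub>m 0" using 0(1) by (intro eq_matI) auto
    show "1\<^sub>m 0 \<in> Upos 0 (staircase 0)" by simp
    show "1\<^sub>m 0 \<in> Bminus 0" by (simp add: Bminus_def GL_iff)
  qed
next
  case (Suc n)
  note M = Suc.prems(1)
  have pos: "M $$ (0, t) > 0" if "t \<le> n" for t
    using Suc.prems(2)[of t 1] that by (simp add: minor_def det_single)
  define N where "N = mat (Suc n) (Suc n) (\<lambda>(i, j). if j = 0 then M $$ (i, 0)
    else M $$ (i, j) - M $$ (0, j) / M $$ (0, j - 1) * M $$ (i, j - 1))"
  define D where "D = mat n n (\<lambda>(i, j). N $$ (Suc i, Suc j))"
  obtain Q where Q: "Q \<in> Upos (Suc n) [0..<n]" "N * Q = M"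
    using Upos_eliminate_row[OF M pos] unfolding N_def by blast
  have D: "D \<in> carrier_mat n n" by (simp add: D_def)
  have "minor D k (\<lambda>t. m + t) > 0" if "m + k \<le> n" for m k
  proof -
    have "minor M (Suc k) (\<lambda>t. m + t) = M $$ (0, m) * det (mat k k (\<lambda>(i, t). M $$ (Suc i, m + Suc t)
        - M $$ (0, m + Suc t) / M $$ (0, m + t) * M $$ (Suc i, m + t)))"
      unfolding minor_def using pos that
      by (subst det_eliminate_row[where b = "\<lambda>i t. M $$ (i, m + t)"]) (auto simp: less_imp_neq[THEN not_sym])
    also have "mat k k (\<lambda>(i, t). M $$ (Suc i, m + Suc t)
        - M $$ (0, m + Suc t) / M $$ (0, m + t) * M $$ (Suc i, m + t)) = mat k k (\<lambda>(i, t). D $$ (i, m + t))"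
      using that by (intro cong_mat) (simp_all add: D_def N_def)
    finally have "minor M (Suc k) (\<lambda>t. m + t) = M $$ (0, m) * minor D k (\<lambda>t. m + t)"
      by (simp add: minor_def)
    moreover have "minor M (Suc k) (\<lambda>t. m + t) > 0" using Suc.prems(2) that by simp
    ultimately show ?thesis using pos[of m] that by (simp add: zero_less_mult_iff)
  qed
  from Suc.IH[OF D this] obtain L' u' where L': "L' \<in> Bminus n" and u': "u' \<in> Upos n (staircase n)"
    and eq: "D = L' * u'" by blast
  have cL': "L' \<in> carrier_mat n n" and dL': "det L' \<noteq> 0" using L' by (auto simp: Bminus_def GL_iff)
  have cu': "u' \<in> carrier_mat n n" using u' by (rule Upos_carrier)
  \<comment> \<open>After elimination the first row is zero beyond its corner and the first column
    is still that of \<open>M\<close>, so this column can be put into the lower triangular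
    factor.\<close>
  define c where "c = mat n 1 (\<lambda>(i, j). M $$ (Suc i, 0))"
  define L where "L = four_block_mat (mat 1 1 (\<lambda>_. M $$ (0, 0))) (0\<^sub>m 1 n) c L'"
  have "det L = M $$ (0, 0) * det L'"
    unfolding L_def
    by (subst det_four_block_mat_upper_right_zero[of _ 1 _ n]) (use cL' in \<open>auto simp: c_def det_single\<close>)
  then have "L \<in> GL (Suc n)"
    using dL' pos[of 0] cL' by (auto simp: GL_iff L_def)
  moreover have "L $$ (i, j) = 0" if "i < j" "j < Suc n" for i j
    using that cL' L' by (auto simp: L_def Bminus_def)
  ultimately have L: "L \<in> Bminus (Suc n)" by (simp add: Bminus_def)
  have "L * shift_mat u' = four_block_mat (mat 1 1 (\<lambda>_. M $$ (0, 0))) (0\<^sub>m 1 n) c D"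
    unfolding L_def shift_mat_def eq using cL' cu'
    by (subst mult_four_block_mat[of _ 1 1 _ n _ n _ _ 1 _ n]) (auto simp: c_def)
  also have "\<dots> = N"
  proof (rule eq_matI)
    fix i j assume "i < dim_row N" "j < dim_col N"
    then have "i < Suc n" "j < Suc n" by (simp_all add: N_def)
    then show "four_block_mat (mat 1 1 (\<lambda>_. M $$ (0, 0))) (0\<^sub>m 1 n) c D $$ (i, j) = N $$ (i, j)"
      using pos[of "j - 1"] by (cases i; cases j) (auto simp: c_def D_def N_def)
  qed (simp_all add: D_def N_def)
  finally have "M = L * shift_mat u' * Q" using Q(2) by simp
  moreover have "L \<in> carrier_mat (Suc n) (Suc n)" using L by (simp add: Bminus_def GL_iff)
  note assoc_mult_mat[OF this shift_mat_carrier[OF cu'] Upos_carrier[OF Q(1)]]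
  ultimately have "M = L * (shift_mat u' * Q)" by metis
  moreover have "shift_mat u' * Q \<in> Upos (Suc n) (staircase (Suc n))"
    unfolding staircase.simps by (rule Upos_append[OF shift_mat_Upos[OF u'] Q(1)])
  ultimately show ?case using L by (intro bexI)
qed

section \<open>Approximation and limits\<close>

lemma plucker_full: "M \<in> carrier_mat n n \<Longrightarrow> plucker M {0..<n} = det M"
proof -
  assume M: "M \<in> carrier_mat n n"
  have "plucker M {0..<n} = minor M n (\<lambda>t. t)"
    by (rule plucker_minor[OF M]) (auto intro: strict_mono_onI)
  also have "mat n n (\<lambda>(i, j). M $$ (i, j)) = M" using M by (intro eq_matI) auto
  then have "minor M n (\<lambda>t. t) = det M" by (simp add: minor_def)
  finally show ?thesis .
qed

text \<open>Expansion along the last row: some cofactor is nonzero, and deleting that row leaves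
  exactly the first \<open>k\<close> rows.\<close>

lemma minor_expand:
  assumes "minor M (Suc k) f \<noteq> 0"
  obtains t where "t \<le> k" "minor M k (f \<circ> insert_index t) \<noteq> 0"
proof -
  define A where "A = mat (Suc k) (Suc k) (\<lambda>(i, j). M $$ (i, f j))"
  have "(\<Sum>t<Suc k. A $$ (k, t) * cofactor A k t) \<noteq> 0"
    using assms laplace_expansion_row[of A "Suc k" k] by (simp add: A_def minor_def)
  then obtain t where "t \<in> {..<Suc k}" "A $$ (k, t) * cofactor A k t \<noteq> 0"
    by (rule sum.not_neutral_contains_not_neutral)
  then have t: "t \<le> k" "cofactor A k t \<noteq> 0" by auto
  have "mat_delete A k t = mat k k (\<lambda>(i, j). M $$ (i, (f \<circ> insert_index t) j))"
    by (rule eq_matI) (auto simp: A_def mat_delete_def insert_index_def)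
  then have "minor M k (f \<circ> insert_index t) \<noteq> 0"
    using t(2) by (simp add: cofactor_def minor_def)
  with t(1) show ?thesis by (rule that)
qed

lemma nonzero_plucker_exists:
  assumes M: "M \<in> carrier_mat n n" "det M \<noteq> 0" and "k \<le> n"
  shows "\<exists>I \<subseteq> {0..<n}. card I = k \<and> plucker M I \<noteq> 0"
  using \<open>k \<le> n\<close>
proof (induction k rule: inc_induct)
  case base
  then show ?case using M plucker_full[OF M(1)] by (intro exI[of _ "{0..<n}"]) simp
next
  case (step k)
  then obtain I where I: "I \<subseteq> {0..<n}" "card I = Suc k" "plucker M I \<noteq> 0" by blast
  have fin: "finite I" using I finite_subset by blast
  have f: "strict_mono_on {..<Suc k} (pick I)" "pick I ` {..<Suc k} = I"
    using strict_mono_pick[OF fin] pick_image[OF fin] I(2) by simp_all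
  from I(3) have "minor M (Suc k) (pick I) \<noteq> 0"
    by (simp add: plucker_pick[OF M(1) I(1)] I(2))
  then obtain t where t: "t \<le> k" "minor M k (pick I \<circ> insert_index t) \<noteq> 0"
    by (rule minor_expand)
  define g where "g = pick I \<circ> insert_index t"
  have g: "strict_mono_on {..<k} g"
  proof (rule strict_mono_onI)
    fix r s assume "r \<in> {..<k}" "s \<in> {..<k}" "r < s"
    then have "insert_index t r < insert_index t s" "insert_index t s < Suc k"
      by (auto simp: insert_index_def)
    then show "g r < g s"
      unfolding g_def comp_apply by (intro strict_mono_onD[OF f(1)]) auto
  qed
  have "g ` {..<k} \<subseteq> pick I ` {..<Suc k}"
    by (auto simp: g_def insert_index_def)
  then have sub: "g ` {..<k} \<subseteq> {0..<n}" using f(2) I(1) by simp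
  have "plucker M (g ` {..<k}) = minor M k g"
    by (rule plucker_minor[OF M(1) sub g]) simp
  moreover have "card (g ` {..<k}) = k"
    using strict_mono_on_imp_inj_on[OF g] by (simp add: card_image)
  ultimately show ?case using sub t(2) unfolding g_def by metis
qed

text \<open>While \<open>I\<close> has a gap just below one of its elements, moving the element into
  the gap lowers the sum of \<open>I\<close>; the process ends at the initial segment. Moving it
  back is also an adjacent exchange, so \<open>exch\<close> gives both directions.\<close>

lemma adjacent_exchange_invariant:
  assumes "I \<subseteq> {0..<n}"
    and exch: "\<And>I q p. I \<subseteq> {0..<n} \<Longrightarrow> q \<in> I \<Longrightarrow> p \<notin> I \<Longrightarrow> p < n \<Longrightarrow> p = Suc q \<or> q = Suc p \<Longrightarrow>
      A (insert p (I - {q})) \<Longrightarrow> A I"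
  shows "A I \<longleftrightarrow> A {0..<card I}"
  using assms(1)
proof (induction "\<Sum>I" arbitrary: I rule: less_induct)
  case less
  have fin: "finite I" using less.prems finite_subset by blast
  show ?case
  proof (cases "\<exists>q. Suc q \<in> I \<and> q \<notin> I")
    case True
    then obtain q where q: "Suc q \<in> I" "q \<notin> I" by blast
    have "q < n" using subsetD[OF less.prems q(1)] by simp
    define J where "J = insert q (I - {Suc q})"
    have J: "J \<subseteq> {0..<n}" using less.prems q by (auto simp: J_def)
    have "\<Sum>I = Suc q + \<Sum>(I - {Suc q})" using sum.remove[OF fin q(1), of "\<lambda>x. x"] .
    moreover have "\<Sum>J = q + \<Sum>(I - {Suc q})" using fin q unfolding J_def by (subst sum.insert) auto
    ultimately have "A J \<longleftrightarrow> A {0..<card J}" using J by (intro less.hyps) simp_all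
    moreover have "card J = card I"
      using fin q card_Suc_Diff1[OF fin q(1)] by (simp add: J_def)
    moreover have "A J \<Longrightarrow> A I"
      by (rule exch[OF less.prems q]) (use less.prems q \<open>q < n\<close> in \<open>simp_all add: J_def subset_iff\<close>)
    moreover have "A I \<Longrightarrow> A J"
    proof (rule exch[OF J, of q "Suc q"])
      have "insert (Suc q) (J - {q}) = I" using q by (auto simp: J_def)
      then show "A I \<Longrightarrow> A (insert (Suc q) (J - {q}))" by simp
    qed (use less.prems q in \<open>simp_all add: J_def subset_iff\<close>)
    ultimately show ?thesis by metis
  next
    case False
    have down: "x \<in> I" if "x \<le> y" "y \<in> I" for x y
      using that by (induction rule: inc_induct) (use False in blast)+
    have "I = {0..<card I}"
    proof (rule card_subset_eq)
      show "I \<subseteq> {0..<card I}"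
      proof
        fix y assume "y \<in> I"
        then have "{0..y} \<subseteq> I" using down by auto
        then have "card {0..y} \<le> card I" by (rule card_mono[OF fin])
        then show "y \<in> {0..<card I}" by simp
      qed
    qed simp_all
    then show ?thesis by (rule arg_cong[where f = A])
  qed
qed

text \<open>Induction on the number of vanishing coordinates. A small column addition makes one of
  them positive and decreases none, so the number drops; half of the error budget is left for the
  rest.\<close>

lemma positive_approximation:
  assumes "M \<in> carrier_mat n n" "det M \<noteq> 0" "\<And>I. I \<subseteq> {0..<n} \<Longrightarrow> plucker M I \<ge> 0" "e > 0"
  shows "\<exists>M' \<in> carrier_mat n n. (\<forall>I \<subseteq> {0..<n}. plucker M' I > 0) \<and>
    (\<forall>i < n. \<forall>j < n. \<bar>M' $$ (i, j) - M $$ (i, j)\<bar> < e)"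
  using assms
proof (induction "card {I \<in> Pow {0..<n}. plucker M I = 0}" arbitrary: M e rule: less_induct)
  case less
  note M = less.prems(1-3)
  show ?case
  proof (cases "\<forall>I \<subseteq> {0..<n}. plucker M I > 0")
    case True
    then show ?thesis using M(1) less.prems(4) by (intro bexI[of _ M]) auto
  next
    case False
    \<comment> \<open>Otherwise nonvanishing would be invariant under adjacent exchanges, and all
      coordinates of the size of some vanishing one would vanish, contradicting
      invertibility.\<close>
    have "\<exists>I q p. I \<subseteq> {0..<n} \<and> q \<in> I \<and> p \<notin> I \<and> p < n \<and> (p = Suc q \<or> q = Suc p) \<and>
      plucker M (insert p (I - {q})) \<noteq> 0 \<and> plucker M I = 0"
    proof (rule ccontr)
      assume contra: "\<not> ?thesis"
      have inv: "plucker M I \<noteq> 0 \<longleftrightarrow> plucker M {0..<card I} \<noteq> 0" if "I \<subseteq> {0..<n}" for I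
        by (rule adjacent_exchange_invariant[OF that, of "\<lambda>I. plucker M I \<noteq> 0"]) (use contra in blast)
      from False obtain I where I: "I \<subseteq> {0..<n}" "\<not> plucker M I > 0" by blast
      then have "plucker M I = 0" using M(3)[OF I(1)] by simp
      moreover have "card I \<le> n" using card_mono[OF _ I(1)] by simp
      ultimately show False
        using nonzero_plucker_exists[OF M(1,2)] inv I(1) by metis
    qed
    then obtain I q p where I: "I \<subseteq> {0..<n}" "q \<in> I" "p \<notin> I" "p < n" "p = Suc q \<or> q = Suc p"
      "plucker M (insert p (I - {q})) \<noteq> 0" "plucker M I = 0" by blast
    \<comment> \<open>\<open>K\<close> bounds the entries of the column being added, so
      \<open>t\<close> changes each entry by at most \<open>e / 2\<close>; the summand 1 keeps the
      denominator positive.\<close>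
    define K where "K = (\<Sum>i<n. \<bar>M $$ (i, p)\<bar>)"
    have K: "K \<ge> 0" by (simp add: K_def sum_nonneg)
    define t where "t = e / 2 / (K + 1)"
    have t: "t > 0" using K less.prems(4) by (simp add: t_def)
    define M1 where "M1 = addcol t q p M"
    have M1: "M1 \<in> carrier_mat n n" using M(1) by (simp add: M1_def mat_addcol_def)
    have "det M1 \<noteq> 0" using det_addcol[OF I(4) _ M(1), of q t] I M(2) by (auto simp: M1_def)
    have ge: "plucker M1 J \<ge> plucker M J" if "J \<subseteq> {0..<n}" for J
    proof -
      have "plucker M (insert p (J - {q})) \<ge> 0" using that I(4) by (intro M(3)) auto
      then show ?thesis
        using t unfolding M1_def plucker_addcol[OF M(1) that I(5,4)] by simp
    qed
    have nonneg: "plucker M1 J \<ge> 0" if "J \<subseteq> {0..<n}" for J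
      using ge[OF that] M(3)[OF that] by linarith
    have "insert p (I - {q}) \<subseteq> {0..<n}" using I(1,4) by auto
    then have "plucker M (insert p (I - {q})) > 0" using M(3) I(6) by (simp add: less_le)
    then have "plucker M1 I > 0"
      using t I unfolding M1_def plucker_addcol[OF M(1) I(1,5,4)] by simp
    moreover have "plucker M J = 0" if "J \<subseteq> {0..<n}" "plucker M1 J = 0" for J
      using ge[OF that(1)] M(3)[OF that(1)] that(2) by linarith
    ultimately have "{J \<in> Pow {0..<n}. plucker M1 J = 0} \<subseteq> {J \<in> Pow {0..<n}. plucker M J = 0}"
      "I \<in> {J \<in> Pow {0..<n}. plucker M J = 0}" "I \<notin> {J \<in> Pow {0..<n}. plucker M1 J = 0}"
      using I(1,7) by auto
    then have "{J \<in> Pow {0..<n}. plucker M1 J = 0} \<subset> {J \<in> Pow {0..<n}. plucker M J = 0}"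
      by blast
    then have "card {J \<in> Pow {0..<n}. plucker M1 J = 0} < card {J \<in> Pow {0..<n}. plucker M J = 0}"
      by (intro psubset_card_mono) simp_all
    moreover have "e / 2 > 0" using less.prems(4) by simp
    ultimately obtain M' where M': "M' \<in> carrier_mat n n" "\<forall>I \<subseteq> {0..<n}. plucker M' I > 0"
      "\<forall>i < n. \<forall>j < n. \<bar>M' $$ (i, j) - M1 $$ (i, j)\<bar> < e / 2"
      using less.hyps[OF _ M1 \<open>det M1 \<noteq> 0\<close> nonneg] by blast
    have "\<bar>M1 $$ (i, j) - M $$ (i, j)\<bar> \<le> e / 2" if "i < n" "j < n" for i j
    proof -
      have "\<bar>M $$ (i, p)\<bar> \<le> K" unfolding K_def by (rule member_le_sum) (use that in auto)
      then have "t * \<bar>M $$ (i, p)\<bar> \<le> t * (K + 1)" using t by (intro mult_left_mono) auto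
      also have "\<dots> = e / 2" using K unfolding t_def by (subst nonzero_eq_divide_eq[symmetric]) simp_all
      finally have "\<bar>t * M $$ (i, p)\<bar> \<le> e / 2" using t by (simp add: abs_mult)
      then show ?thesis using that M(1) less.prems(4) by (auto simp: M1_def)
    qed
    then have "\<bar>M' $$ (i, j) - M $$ (i, j)\<bar> < e" if "i < n" "j < n" for i j
      using M'(3) that by (smt (verit) field_sum_of_halves)
    then show ?thesis using M' by blast
  qed
qed

text \<open>The approximating matrices themselves form the required sequence: their interval minors
  are positive, so they factor along the staircase word, and the positive factor is then transferred
  to \<open>ws\<close>.\<close>

lemma nonneg_pluckers_imp_tnn_flag:
  assumes w: "reduced_word_w0 n ws" and M: "M \<in> GL n" "\<And>I. I \<subseteq> {0..<n} \<Longrightarrow> plucker M I \<ge> 0"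
  shows "tnn_flag n ws M"
proof -
  have car: "M \<in> carrier_mat n n" "det M \<noteq> 0" using M(1) by (simp_all add: GL_iff)
  have "\<exists>X \<in> carrier_mat n n. (\<forall>I \<subseteq> {0..<n}. plucker X I > 0) \<and>
    (\<forall>i < n. \<forall>j < n. \<bar>X $$ (i, j) - M $$ (i, j)\<bar> < 1 / real (Suc k))" for k
    by (rule positive_approximation[OF car M(2)]) auto
  then obtain X where X: "\<And>k. X k \<in> carrier_mat n n" "\<And>k I. I \<subseteq> {0..<n} \<Longrightarrow> plucker (X k) I > 0"
    "\<And>k i j. i < n \<Longrightarrow> j < n \<Longrightarrow> \<bar>X k $$ (i, j) - M $$ (i, j)\<bar> < 1 / real (Suc k)"
    by metis
  have "\<exists>u \<in> Upos n ws. same_flag n u (X k)" for k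
  proof -
    have "minor (X k) l (\<lambda>t. m + t) > 0" if "m + l \<le> n" for m l
    proof -
      have sub: "{m..<m + l} \<subseteq> {0..<n}" using that by auto
      have "(\<lambda>t. m + t) ` {..<l} = {m..<m + l}"
        using image_add_atLeastLessThan[of m 0 l] by (simp add: atLeast0LessThan add.commute)
      then have "plucker (X k) {m..<m + l} = minor (X k) l (\<lambda>t. m + t)"
        by (intro plucker_minor[OF X(1) sub]) (auto intro: strict_mono_onI)
      then show ?thesis using X(2)[OF sub, of k] by simp
    qed
    then obtain L u where Lu: "L \<in> Bminus n" "u \<in> Upos n (staircase n)" "X k = L * u"
      using interval_minors_factorization[OF X(1)] by blast
    have u: "u \<in> carrier_mat n n" using Lu(2) by (rule Upos_carrier)
    have L: "L \<in> carrier_mat n n" using Lu(1) by (simp add: Bminus_def GL_iff)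
    have "det (X k) > 0" using X(2)[of "{0..<n}" k] plucker_full[OF X(1)] by simp
    then have "u \<in> GL n" using Lu(3) det_mult[OF L u] u by (auto simp: GL_iff)
    then have "same_flag n u (X k)" using Lu(1,3) by (auto simp: same_flag_def)
    then show ?thesis using Lu(2) Upos_reduced_word_w0[OF w] by blast
  qed
  moreover have "(\<lambda>k. X k $$ (i, j)) \<longlonglongrightarrow> M $$ (i, j)" if "i < n" "j < n" for i j
  proof (rule metric_tendsto_imp_tendsto)
    show "\<forall>\<^sub>F k in sequentially. dist (X k $$ (i, j)) (M $$ (i, j)) \<le> dist (1 / real (Suc k)) 0"
      using X(3)[OF that] by (intro always_eventually allI) (simp add: dist_real_def less_imp_le)
    show "(\<lambda>k. 1 / real (Suc k)) \<longlonglongrightarrow> 0"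
      using LIMSEQ_inverse_real_of_nat by (simp add: inverse_eq_divide)
  qed
  ultimately show ?thesis using M(1) unfolding tnn_flag_def by blast
qed

section \<open>Limits of positive flags and normalization of signs\<close>

lemma tendsto_plucker:
  assumes X: "\<And>k. X k \<in> carrier_mat n n" and M: "M \<in> carrier_mat n n"
    and lim: "\<And>i j. i < n \<Longrightarrow> j < n \<Longrightarrow> (\<lambda>k. X k $$ (i, j)) \<longlonglongrightarrow> M $$ (i, j)"
    and I: "I \<subseteq> {0..<n}"
  shows "(\<lambda>k. plucker (X k) I) \<longlonglongrightarrow> plucker M I"
proof -
  have c: "card I \<le> n" using card_mono[OF _ I] by simp
  have lt: "pick I j < n" if "j < card I" for j using pick_in_set[of j I] that I by auto
  have perm: "p i < card I" if "p permutes {0..<card I}" "i < card I" for p i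
    using permutes_in_image[OF that(1), of i] that(2) by simp
  have det: "minor N (card I) (pick I) = (\<Sum>p | p permutes {0..<card I}.
      signof p * (\<Prod>i = 0..<card I. N $$ (i, pick I (p i))))" for N
    unfolding minor_def by (subst det_def'[of _ "card I"])
      (auto intro!: sum.cong prod.cong simp: perm)
  show ?thesis
    unfolding plucker_pick[OF X I] plucker_pick[OF M I] det
  proof (intro tendsto_sum tendsto_mult tendsto_const tendsto_prod lim)
    fix p i assume "p \<in> {p. p permutes {0..<card I}}" "i \<in> {0..<card I}"
    then have "i < card I" "p i < card I" using perm by auto
    then show "i < n" "pick I (p i) < n" using c lt by auto
  qed
qed

text \<open>In a product of two coordinates of equal size the factor from \<open>L\<close> is
  squared, so its sign disappears. Unlike nonnegativity of single coordinates, this condition does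
  not depend on the representative, and it is closed under limits.\<close>

lemma same_flag_plucker_product_nonneg:
  assumes "same_flag n u X" "u \<in> Upos n ws" "set ws \<subseteq> {0..<n - 1}"
    and I: "I \<subseteq> {0..<n}" and J: "J \<subseteq> {0..<n}" and "card I = card J"
  shows "plucker X I * plucker X J \<ge> 0"
proof -
  obtain L where L: "L \<in> Bminus n" "X = L * u" using assms(1) by (auto simp: same_flag_def)
  have "plucker X K = (\<Prod>i<card K. L $$ (i, i)) * plucker u K" if "K \<subseteq> {0..<n}" for K
    unfolding L(2) using L(1)
    by (intro plucker_lower_mult[OF _ _ Upos_carrier[OF assms(2)] that]) (auto simp: Bminus_def GL_iff)
  then have "plucker X I * plucker X J =
      (\<Prod>i<card J. L $$ (i, i))\<^sup>2 * (plucker u I * plucker u J)"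
    using I J assms(6) by (simp add: power2_eq_square)
  then show ?thesis
    using plucker_Upos_nonneg[OF assms(2,3)] I J by simp
qed

lemma tnn_flag_plucker_product_nonneg:
  assumes "tnn_flag n ws M" "set ws \<subseteq> {0..<n - 1}"
    and I: "I \<subseteq> {0..<n}" and J: "J \<subseteq> {0..<n}" and "card I = card J"
  shows "plucker M I * plucker M J \<ge> 0"
proof -
  obtain X where X: "\<And>k. \<exists>u \<in> Upos n ws. same_flag n u (X k)"
    "\<And>i j. i < n \<Longrightarrow> j < n \<Longrightarrow> (\<lambda>k. X k $$ (i, j)) \<longlonglongrightarrow> M $$ (i, j)"
    using assms(1) by (auto simp: tnn_flag_def)
  have M: "M \<in> carrier_mat n n" using assms(1) by (simp add: tnn_flag_def GL_iff)
  have "X k \<in> carrier_mat n n" for k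
    using X(1)[of k] Upos_carrier by (auto simp: same_flag_def Bminus_def GL_iff)
  then have "(\<lambda>k. plucker (X k) I * plucker (X k) J) \<longlonglongrightarrow> plucker M I * plucker M J"
    using X(2) M I J by (intro tendsto_mult tendsto_plucker) auto
  moreover have "plucker (X k) I * plucker (X k) J \<ge> 0" for k
    using X(1)[of k] same_flag_plucker_product_nonneg[OF _ _ assms(2) I J assms(5)] by blast
  ultimately show ?thesis by (intro tendsto_lowerbound[where F = sequentially]) auto
qed

text \<open>All nonzero coordinates of size \<open>k\<close> share the sign \<open>s k\<close>.
  Scaling row \<open>i\<close> by \<open>s i * s (Suc i)\<close> makes the factor for size
  \<open>k\<close> telescope to \<open>s 0 * s k\<close>.\<close>

lemma sign_normalization:
  assumes M: "M \<in> GL n"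
    and prod: "\<And>I J. I \<subseteq> {0..<n} \<Longrightarrow> J \<subseteq> {0..<n} \<Longrightarrow> card I = card J \<Longrightarrow> plucker M I * plucker M J \<ge> 0"
  shows "\<exists>N \<in> GL n. (\<forall>I \<subseteq> {0..<n}. plucker N I \<ge> 0) \<and> support n N = support n M"
proof -
  have car: "M \<in> carrier_mat n n" and dM: "det M \<noteq> 0" using M by (simp_all add: GL_iff)
  define s :: "nat \<Rightarrow> real" where
    "s k = (if \<exists>I \<subseteq> {0..<n}. card I = k \<and> plucker M I < 0 then -1 else 1)" for k
  have s2: "s k * s k = 1" for k by (simp add: s_def)
  have snz: "s k \<noteq> 0" for k by (simp add: s_def)
  have s: "s (card I) * plucker M I \<ge> 0" if I: "I \<subseteq> {0..<n}" for I
  proof (cases "\<exists>J \<subseteq> {0..<n}. card J = card I \<and> plucker M J < 0")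
    case True
    then obtain J where J: "J \<subseteq> {0..<n}" "card J = card I" "plucker M J < 0" by blast
    then have "plucker M I \<le> 0" using prod[OF J(1) I] by (simp add: zero_le_mult_iff)
    then show ?thesis using True by (simp add: s_def)
  next
    case False
    then have "plucker M I \<ge> 0" using I by force
    then show ?thesis using False unfolding s_def by simp
  qed
  define D where "D = mat n n (\<lambda>(i, j). if i = j then s i * s (Suc i) else 0)"
  have D: "D \<in> carrier_mat n n" by (simp add: D_def)
  have tele: "(\<Prod>i<k. s i * s (Suc i)) = s 0 * s k" for k
    using s2 by (induction k) (simp_all add: algebra_simps)
  have pl: "plucker (D * M) I = s 0 * (s (card I) * plucker M I)" if I: "I \<subseteq> {0..<n}" for I
  proof -
    have "card I \<le> n" using card_mono[OF _ I] by simp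
    then have "(\<Prod>i<card I. D $$ (i, i)) = s 0 * s (card I)"
      unfolding tele[symmetric] by (intro prod.cong) (auto simp: D_def)
    then show ?thesis using plucker_lower_mult[OF D _ car I] by (simp add: D_def)
  qed
  have "plucker M {} = 1" by (simp add: plucker_pick[OF car] minor_def)
  \<comment> \<open>The empty set is the only index set of size 0, and its coordinate is 1, so no
    negative one exists.\<close>
  then have "s 0 = 1"
    unfolding s_def by (auto dest!: finite_subset)
  have DM: "D * M \<in> carrier_mat n n" using D car by simp
  have "det (D * M) \<noteq> 0"
    using pl[of "{0..<n}"] plucker_full[OF DM] plucker_full[OF car] snz dM by simp
  then have "D * M \<in> GL n" using DM by (simp add: GL_iff)
  moreover have "\<forall>I \<subseteq> {0..<n}. plucker (D * M) I \<ge> 0"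
    using pl s \<open>s 0 = 1\<close> by simp
  moreover have "support n (D * M) = support n M"
    unfolding support_def using pl snz by auto
  ultimately show ?thesis by blast
qed

theorem theorem3:
  fixes n :: nat and ws :: "nat list"
  assumes "n \<ge> 2" and "reduced_word_w0 n ws"
  shows "{S. synthetic_flag_positroid n S} = {S. realizable_flag_positroid n ws S}"
proof (intro equalityI subsetI CollectI; drule CollectD)
  fix S assume "synthetic_flag_positroid n S"
  \<comment> \<open>The same matrix witnesses both notions, so the support needs no
    comparison.\<close>
  then show "realizable_flag_positroid n ws S"
    using nonneg_pluckers_imp_tnn_flag[OF assms(2)]
    unfolding synthetic_flag_positroid_def realizable_flag_positroid_def by blast
next
  fix S assume "realizable_flag_positroid n ws S"
  then obtain M where M: "tnn_flag n ws M" "S = support n M"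
    by (auto simp: realizable_flag_positroid_def)
  have "set ws \<subseteq> {0..<n - 1}" using assms(2) by (simp add: reduced_word_w0_def)
  moreover have "M \<in> GL n" using M(1) by (simp add: tnn_flag_def)
  ultimately obtain N where "N \<in> GL n" "\<forall>I \<subseteq> {0..<n}. plucker N I \<ge> 0" "support n N = support n M"
    using sign_normalization[of M n] tnn_flag_plucker_product_nonneg[OF M(1)] by blast
  then show "synthetic_flag_positroid n S"
    using M(2) unfolding synthetic_flag_positroid_def by metis
qed

end
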